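(* Let $\mathrm{R}$ be any collection of sequences in $\Lambda''$, let $F_j:\Lambda\times X\to Y$ ($j\in\mathbb{N}$), $\phi:[0,\infty)\to[0,\infty)$, $\mathbb{F}:\Lambda\to(0,\infty)$, and suppose that $F_j$ is $(\phi,\mathrm{R},\mathcal{B},\mathbb{F},\mathcal{P})$-normal for all $j\in\mathbb{N}$. Let $F:\Lambda\times X\to Y$ be such that, for every $B\in\mathcal{B}$ and every sequence $(\mathbf{b}_k)_{k\in\mathbb{N}}$ in $\mathrm{R}$, $$\lim_{(j,k)\to+\infty}\sup_{x\in B}\Bigl\|\mathbb{F}(\cdot)\,\phi\bigl(\|F_j(\cdot+\mathbf{b}_j;x)-F(\cdot+\mathbf{b}_k;x)\|_Y\bigr)\Bigr\|_P=0.$$ Suppose further that: (i) $\phi$ is monotonically increasing and there exists a finite real constant $c>0$ such that $\phi(x+y)\le c[\phi(x)+\phi(y)]$ for all $x,y\ge 0$; (ii) there exists a finite real constant $\kappa>0$ such that the assumptions $f,g,h\in P$ and $0\le w\le d'[f+g+h]$ for some finite real constant $d'>0$ imply $w\in P$ and $\|w\|_P\le\kappa(1+d')[\|f\|_P+\|g\|_P+\|h\|_P]$. Then $F$ is $(\phi,\mathrm{R},\mathcal{B},\mathbb{F},\mathcal{P})$-normal.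
   Context: $X,Y$ are complex Banach spaces, $n\in\mathbb{N}$, $\emptyset\ne\Lambda\subseteq\mathbb{R}^n$, $\Lambda''=\{\tau\in\mathbb{R}^n:\tau+\Lambda\subseteq\Lambda\}$. $\mathcal{B}$ is a non-empty collection of non-empty subsets of $X$ such that every $x\in X$ lies in some $B\in\mathcal{B}$. $P$ is a set of functions $\Lambda\to[0,\infty)$ containing the zero function, and $\mathcal{P}=(P,d)$ is a pseudometric space; $\|f\|_P:=d(f,0)$, and writing $\|f\|_P$ entails $f\in P$. The limit $(j,k)\to+\infty$ means $\min(j,k)\to+\infty$. A function $G:\Lambda\times X\to Y$ is $(\phi,\mathrm{R},\mathcal{B},\mathbb{F},\mathcal{P})$-normal if for every $B\in\mathcal{B}$ and every sequence $(\mathbf{b}_k)_{k\in\mathbb{N}}$ in $\mathrm{R}$ there exists a subsequence $(\mathbf{b}_{k_m})_{m\in\mathbb{N}}$ such that for every $\epsilon>0$ there is $m_0\in\mathbb{N}$ with $$\sup_{x\in B}\Bigl\|\mathbb{F}(\cdot)\,\phi\bigl(\|G(\cdot+\mathbf{b}_{k_m};x)-G(\cdot+\mathbf{b}_{k_{m'}};x)\|_Y\bigr)\Bigr\|_P<\epsilon\quad\text{for all } m,m'\ge m_0.$$ *)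

theory Defs
  imports "HOL-Analysis.Analysis"
begin

class complex_banach = banach +
  fixes scaleC :: "complex \<Rightarrow> 'a \<Rightarrow> 'a"
  assumes scaleC_add_right: "scaleC a (x + y) = scaleC a x + scaleC a y"
    and scaleC_add_left: "scaleC (a + b) x = scaleC a x + scaleC b x"
    and scaleC_scaleC: "scaleC a (scaleC b x) = scaleC (a * b) x"
    and scaleC_of_real: "scaleC (complex_of_real r) x = r *\<^sub>R x"
    and norm_scaleC: "norm (scaleC a x) = cmod a * norm x"

instantiation complex :: complex_banach
begin

definition scaleC_complex :: "complex \<Rightarrow> complex \<Rightarrow> complex"
  where "scaleC_complex a x = a * x"

instance
  by standard
    (simp_all add: scaleC_complex_def algebra_simps norm_mult scaleR_conv_of_real)

end

definition translation_domain :: "(real ^ 'n) set \<Rightarrow> (real ^ 'n) set"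
  where "translation_domain \<Lambda> = {\<tau>. \<forall>t\<in>\<Lambda>. \<tau> + t \<in> \<Lambda>}"

definition pseudometric_on :: "'a set \<Rightarrow> ('a \<Rightarrow> 'a \<Rightarrow> real) \<Rightarrow> bool"
  where "pseudometric_on P d \<longleftrightarrow>
    (\<forall>f\<in>P. \<forall>g\<in>P. 0 \<le> d f g) \<and>
    (\<forall>f\<in>P. d f f = 0) \<and>
    (\<forall>f\<in>P. \<forall>g\<in>P. d f g = d g f) \<and>
    (\<forall>f\<in>P. \<forall>g\<in>P. \<forall>h\<in>P. d f h \<le> d f g + d g h)"

text \<open>
  A function from \<open>\<Lambda>\<close> to the nonnegative reals is an element of \<open>\<Lambda> \<rightarrow>\<^sub>E {0..}\<close>, so that it is
  determined by its values on \<open>\<Lambda>\<close>; in particular \<open>\<lambda>t\<in>\<Lambda>. 0\<close> is the zero function.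
\<close>

definition function_pseudometric_space ::
    "(real ^ 'n) set \<Rightarrow> (real ^ 'n \<Rightarrow> real) set \<Rightarrow>
      ((real ^ 'n \<Rightarrow> real) \<Rightarrow> (real ^ 'n \<Rightarrow> real) \<Rightarrow> real) \<Rightarrow> bool"
  where "function_pseudometric_space \<Lambda> P d \<longleftrightarrow>
    P \<subseteq> \<Lambda> \<rightarrow>\<^sub>E {0..} \<and> (\<lambda>t\<in>\<Lambda>. 0) \<in> P \<and> pseudometric_on P d"

definition pnorm ::
    "(real ^ 'n) set \<Rightarrow> ((real ^ 'n \<Rightarrow> real) \<Rightarrow> (real ^ 'n \<Rightarrow> real) \<Rightarrow> real) \<Rightarrow>
      (real ^ 'n \<Rightarrow> real) \<Rightarrow> real"
  where "pnorm \<Lambda> d f = d f (\<lambda>t\<in>\<Lambda>. 0)"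

text \<open>
  The convention that writing the \<open>P\<close>-norm of \<open>f\<close> entails \<open>f \<in> P\<close> is encoded by the value
  \<open>\<infinity>\<close> outside \<open>P\<close>: a supremum of such norms that is below a real \<open>\<epsilon>\<close> forces all the functions
  involved to belong to \<open>P\<close>.
\<close>

definition epnorm ::
    "(real ^ 'n) set \<Rightarrow> (real ^ 'n \<Rightarrow> real) set \<Rightarrow>
      ((real ^ 'n \<Rightarrow> real) \<Rightarrow> (real ^ 'n \<Rightarrow> real) \<Rightarrow> real) \<Rightarrow> (real ^ 'n \<Rightarrow> real) \<Rightarrow> ennreal"
  where "epnorm \<Lambda> P d f = (if f \<in> P then ennreal (pnorm \<Lambda> d f) else \<infinity>)"

text \<open>
  Functions on \<open>\<Lambda> \<times> X\<close> are curried and total. Only their values at points of \<open>\<Lambda>\<close> matter, as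
  the translations occurring below map \<open>\<Lambda>\<close> into itself.
\<close>

definition sup_pnorm_diff ::
    "(real \<Rightarrow> real) \<Rightarrow> (real ^ 'n \<Rightarrow> real) \<Rightarrow> (real ^ 'n) set \<Rightarrow> (real ^ 'n \<Rightarrow> real) set \<Rightarrow>
      ((real ^ 'n \<Rightarrow> real) \<Rightarrow> (real ^ 'n \<Rightarrow> real) \<Rightarrow> real) \<Rightarrow> 'x set \<Rightarrow>
      (real ^ 'n \<Rightarrow> 'x \<Rightarrow> 'y::real_normed_vector) \<Rightarrow> real ^ 'n \<Rightarrow>
      (real ^ 'n \<Rightarrow> 'x \<Rightarrow> 'y) \<Rightarrow> real ^ 'n \<Rightarrow> ennreal"
  where "sup_pnorm_diff \<phi> \<F> \<Lambda> P d B G a H b =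
    (SUP x\<in>B. epnorm \<Lambda> P d (\<lambda>t\<in>\<Lambda>. \<F> t * \<phi> (norm (G (t + a) x - H (t + b) x))))"

definition normal_function ::
    "(real \<Rightarrow> real) \<Rightarrow> (nat \<Rightarrow> real ^ 'n) set \<Rightarrow> 'x set set \<Rightarrow> (real ^ 'n \<Rightarrow> real) \<Rightarrow>
      (real ^ 'n) set \<Rightarrow> (real ^ 'n \<Rightarrow> real) set \<Rightarrow>
      ((real ^ 'n \<Rightarrow> real) \<Rightarrow> (real ^ 'n \<Rightarrow> real) \<Rightarrow> real) \<Rightarrow>
      (real ^ 'n \<Rightarrow> 'x \<Rightarrow> 'y::real_normed_vector) \<Rightarrow> bool"
  where "normal_function \<phi> R \<B> \<F> \<Lambda> P d G \<longleftrightarrow>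
    (\<forall>B\<in>\<B>. \<forall>b\<in>R. \<exists>r :: nat \<Rightarrow> nat. strict_mono r \<and>
      (\<forall>\<epsilon>>0. \<exists>m0. \<forall>m\<ge>m0. \<forall>m'\<ge>m0.
        sup_pnorm_diff \<phi> \<F> \<Lambda> P d B G (b (r m)) G (b (r m')) < ennreal \<epsilon>))"

end

theory Submission
  imports Defs
begin

text \<open>
  In the double limit \<open>j\<close> and \<open>k\<close> tend to infinity independently. Hence, for a single large
  \<open>j\<close>, all translates \<open>F (\<cdot> + b k)\<close> with \<open>k \<ge> j\<close> are close to the same function
  \<open>F\<^sub>j (\<cdot> + b j)\<close>, and a quasi-triangle inequality shows that the whole sequence of translates
  of \<open>F\<close> is Cauchy, without passing to a subsequence.
\<close>

text \<open>The translate \<open>G (t + a) x\<close> serves as a common midpoint. Monotonicity and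
  quasi-subadditivity of \<open>\<phi>\<close> turn the triangle inequality in \<open>'y\<close>
  into a pointwise bound with constant \<open>c\<close>; the domination property of \<open>P\<close>
  with \<open>d' = c\<close> lifts it to norms, whence the factor
  \<open>\<kappa> * (1 + c)\<close>.\<close>

lemma sup_pnorm_diff_quasi_triangle:
  fixes G H H' :: "real ^ 'n \<Rightarrow> 'x \<Rightarrow> 'y::real_normed_vector"
  assumes space: "function_pseudometric_space \<Lambda> P d"
    and phi: "\<phi> \<in> {0..} \<rightarrow> {0..}" "mono_on {0..} \<phi>"
    and weight: "\<F> \<in> \<Lambda> \<rightarrow> {0<..}"
    and c: "c > 0" "\<forall>x\<ge>0. \<forall>y\<ge>0. \<phi> (x + y) \<le> c * (\<phi> x + \<phi> y)"
    and \<kappa>: "\<kappa> > 0" "\<forall>f\<in>P. \<forall>g\<in>P. \<forall>h\<in>P. \<forall>w\<in>extensional \<Lambda>. \<forall>d'>0.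
      (\<forall>t\<in>\<Lambda>. 0 \<le> w t \<and> w t \<le> d' * (f t + g t + h t)) \<longrightarrow>
        w \<in> P \<and> pnorm \<Lambda> d w \<le> \<kappa> * (1 + d') * (pnorm \<Lambda> d f + pnorm \<Lambda> d g + pnorm \<Lambda> d h)"
  shows "sup_pnorm_diff \<phi> \<F> \<Lambda> P d B H b H' b' \<le> ennreal (\<kappa> * (1 + c)) *
    (sup_pnorm_diff \<phi> \<F> \<Lambda> P d B G a H b + sup_pnorm_diff \<phi> \<F> \<Lambda> P d B G a H' b')"
proof -
  define K where "K = \<kappa> * (1 + c)"
  have "K > 0"
    using c(1) \<kappa>(1) by (simp add: K_def)
  have zero: "(\<lambda>t\<in>\<Lambda>. 0) \<in> P"
    using space by (simp add: function_pseudometric_space_def)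
  have zero_norm: "pnorm \<Lambda> d (\<lambda>t\<in>\<Lambda>. 0) = 0" and norm_nonneg: "\<And>f. f \<in> P \<Longrightarrow> 0 \<le> pnorm \<Lambda> d f"
    using space zero by (auto simp: function_pseudometric_space_def pseudometric_on_def pnorm_def)
  define D where "D U u V v x = (\<lambda>t\<in>\<Lambda>. \<F> t * \<phi> (norm (U (t + u) x - V (t + v) x)))"
    for U V :: "real ^ 'n \<Rightarrow> 'x \<Rightarrow> 'y" and u v x
  have sup_D: "sup_pnorm_diff \<phi> \<F> \<Lambda> P d B U u V v = (SUP x\<in>B. epnorm \<Lambda> P d (D U u V v x))"
    for U V :: "real ^ 'n \<Rightarrow> 'x \<Rightarrow> 'y" and u v
    by (simp add: sup_pnorm_diff_def D_def)
  have "epnorm \<Lambda> P d (D H b H' b' x) \<le> ennreal K *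
      (epnorm \<Lambda> P d (D G a H b x) + epnorm \<Lambda> P d (D G a H' b' x))" for x
  proof (cases "D G a H b x \<in> P \<and> D G a H' b' x \<in> P")
    case True
    \<comment> \<open>The domination property takes three functions. The zero function fills the
      third slot; its norm vanishes, so it adds nothing to the final estimate.\<close>
    have bound: "0 \<le> D H b H' b' x t \<and>
        D H b H' b' x t \<le> c * (D G a H b x t + D G a H' b' x t + (\<lambda>t\<in>\<Lambda>. 0) t)"
      if t: "t \<in> \<Lambda>" for t
    proof -
      let ?u = "G (t + a) x - H (t + b) x" and ?v = "G (t + a) x - H' (t + b') x"
      let ?w = "H (t + b) x - H' (t + b') x"
      \<comment> \<open>Here \<open>?w = ?v - ?u\<close>, since the midpoint cancels.\<close>
      have w: "norm ?w \<le> norm ?u + norm ?v"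
        using norm_triangle_ineq4[of ?v ?u] by simp
      have "\<phi> (norm ?w) \<le> \<phi> (norm ?u + norm ?v)"
        using w by (intro mono_onD[OF phi(2)]) auto
      also have "\<dots> \<le> c * (\<phi> (norm ?u) + \<phi> (norm ?v))"
        using c(2) by simp
      finally have le: "\<phi> (norm ?w) \<le> c * (\<phi> (norm ?u) + \<phi> (norm ?v))" .
      have pos: "\<F> t > 0" "\<phi> (norm ?w) \<ge> 0"
        using weight phi(1) t by auto
      show ?thesis
        using mult_left_mono[OF le, of "\<F> t"] pos t by (simp add: D_def algebra_simps)
    qed
    have "D H b H' b' x \<in> extensional \<Lambda>"
      by (simp add: D_def)
    \<comment> \<open>Domination yields membership in \<open>P\<close> as well as the estimate, so
      \<open>epnorm\<close> of the left-hand function is its real norm and not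
      \<open>\<infinity>\<close>.\<close>
    then have "D H b H' b' x \<in> P \<and> pnorm \<Lambda> d (D H b H' b' x) \<le> K *
        (pnorm \<Lambda> d (D G a H b x) + pnorm \<Lambda> d (D G a H' b' x) + pnorm \<Lambda> d (\<lambda>t\<in>\<Lambda>. 0))"
      unfolding K_def using \<kappa>(2) True zero c(1) bound by blast
    then show ?thesis
      using True norm_nonneg \<open>K > 0\<close>
      by (simp add: epnorm_def zero_norm ennreal_leI flip: ennreal_plus ennreal_mult)
  next
    \<comment> \<open>A function outside \<open>P\<close> makes the sum on the right infinite. As
      \<open>K > 0\<close>, the product stays infinite, whereas \<open>0 * \<infinity> = 0\<close>
      in \<open>ennreal\<close>.\<close>
    case False
    then show ?thesis
      using \<open>K > 0\<close> by (auto simp: epnorm_def ennreal_mult_top)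
  qed
  \<comment> \<open>Passing to suprema over \<open>B\<close> makes the bound independent of
    \<open>x\<close>, so that it also bounds the supremum on the left.\<close>
  also have "ennreal K * (epnorm \<Lambda> P d (D G a H b x) + epnorm \<Lambda> P d (D G a H' b' x)) \<le> ennreal K *
      (sup_pnorm_diff \<phi> \<F> \<Lambda> P d B G a H b + sup_pnorm_diff \<phi> \<F> \<Lambda> P d B G a H' b')"
    if "x \<in> B" for x
    unfolding sup_D using that by (intro mult_left_mono add_mono SUP_upper) auto
  finally show ?thesis
    unfolding sup_D[of H] K_def by (intro SUP_least)
qed

theorem proposition2p5:
  fixes \<Lambda> :: "(real ^ 'n) set"
    and \<B> :: "'x::complex_banach set set"
    and P :: "(real ^ 'n \<Rightarrow> real) set"
    and d :: "(real ^ 'n \<Rightarrow> real) \<Rightarrow> (real ^ 'n \<Rightarrow> real) \<Rightarrow> real"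
    and R :: "(nat \<Rightarrow> real ^ 'n) set"
    and Fs :: "nat \<Rightarrow> real ^ 'n \<Rightarrow> 'x \<Rightarrow> 'y::complex_banach"
    and F :: "real ^ 'n \<Rightarrow> 'x \<Rightarrow> 'y"
    and \<phi> :: "real \<Rightarrow> real"
    and \<F> :: "real ^ 'n \<Rightarrow> real"
  assumes "\<Lambda> \<noteq> {}"
    and "\<B> \<noteq> {}" and "{} \<notin> \<B>" and "\<Union>\<B> = UNIV"
    and "function_pseudometric_space \<Lambda> P d"
    and "\<forall>b\<in>R. range b \<subseteq> translation_domain \<Lambda>"
    and "\<phi> \<in> {0..} \<rightarrow> {0..}"
    and "\<F> \<in> \<Lambda> \<rightarrow> {0<..}"
    and "\<forall>j. normal_function \<phi> R \<B> \<F> \<Lambda> P d (Fs j)"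
    and "\<forall>B\<in>\<B>. \<forall>b\<in>R.
      ((\<lambda>(j, k). sup_pnorm_diff \<phi> \<F> \<Lambda> P d B (Fs j) (b j) F (b k)) \<longlongrightarrow> 0)
        (filtercomap (\<lambda>(j, k). min j k) sequentially)"
    and "mono_on {0..} \<phi>"
    and "\<exists>c>0. \<forall>x\<ge>0. \<forall>y\<ge>0. \<phi> (x + y) \<le> c * (\<phi> x + \<phi> y)"
    and "\<exists>\<kappa>>0. \<forall>f\<in>P. \<forall>g\<in>P. \<forall>h\<in>P. \<forall>w\<in>extensional \<Lambda>. \<forall>d'>0.
      (\<forall>t\<in>\<Lambda>. 0 \<le> w t \<and> w t \<le> d' * (f t + g t + h t)) \<longrightarrow>
        w \<in> P \<and> pnorm \<Lambda> d w \<le> \<kappa> * (1 + d') * (pnorm \<Lambda> d f + pnorm \<Lambda> d g + pnorm \<Lambda> d h)"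
  shows "normal_function \<phi> R \<B> \<F> \<Lambda> P d F"
  unfolding normal_function_def
proof (intro ballI)
  fix B b assume "B \<in> \<B>" "b \<in> R"
  let ?S = "sup_pnorm_diff \<phi> \<F> \<Lambda> P d B"
  from assms(12) obtain c
    where c: "c > 0" "\<forall>x\<ge>0. \<forall>y\<ge>0. \<phi> (x + y) \<le> c * (\<phi> x + \<phi> y)"
    by blast
  from assms(13) obtain \<kappa> where \<kappa>: "\<kappa> > 0" "\<forall>f\<in>P. \<forall>g\<in>P. \<forall>h\<in>P. \<forall>w\<in>extensional \<Lambda>. \<forall>d'>0.
      (\<forall>t\<in>\<Lambda>. 0 \<le> w t \<and> w t \<le> d' * (f t + g t + h t)) \<longrightarrow>
        w \<in> P \<and> pnorm \<Lambda> d w \<le> \<kappa> * (1 + d') * (pnorm \<Lambda> d f + pnorm \<Lambda> d g + pnorm \<Lambda> d h)"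
    by blast
  define K where "K = \<kappa> * (1 + c)"
  have "K > 0"
    using c(1) \<kappa>(1) by (simp add: K_def)
  have Cauchy: "\<exists>N. \<forall>m\<ge>N. \<forall>m'\<ge>N. ?S F (b m) F (b m') < ennreal \<epsilon>" if "\<epsilon> > 0" for \<epsilon> :: real
  proof -
    \<comment> \<open>Two terms below \<open>\<delta>\<close>, multiplied by \<open>K\<close>, give
      at most \<open>\<epsilon> / 2\<close>; this slack restores strictness after the non-strict
      estimates.\<close>
    define \<delta> where "\<delta> = \<epsilon> / (4 * K)"
    have "\<delta> > 0"
      using \<open>K > 0\<close> that by (simp add: \<delta>_def)
    have "\<forall>\<^sub>F p in filtercomap (\<lambda>(j, k). min j k) sequentially.
        (\<lambda>(j, k). ?S (Fs j) (b j) F (b k)) p < ennreal \<delta>"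
      using assms(10) \<open>B \<in> \<B>\<close> \<open>b \<in> R\<close> \<open>\<delta> > 0\<close> by (intro order_tendstoD(2)) auto
    \<comment> \<open>A property eventual along the pullback of \<open>sequentially\<close> under
      \<open>min\<close> holds for all pairs whose two indices both reach some
      \<open>N\<close>.\<close>
    then obtain N where N: "?S (Fs j) (b j) F (b k) < ennreal \<delta>" if "min j k \<ge> N" for j k
      unfolding eventually_filtercomap eventually_sequentially by fastforce
    have "?S F (b m) F (b m') < ennreal \<epsilon>" if "m \<ge> N" "m' \<ge> N" for m m'
    proof -
      \<comment> \<open>The index \<open>j\<close> is frozen at \<open>N\<close>, so the midpoint is
        \<open>Fs N\<close> shifted by \<open>b N\<close>. The pairs \<open>(N, m)\<close> and
        \<open>(N, m')\<close> both have minimum \<open>N\<close>, so the bound from the double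
        limit applies to each.\<close>
      have "?S F (b m) F (b m') \<le> ennreal K *
          (?S (Fs N) (b N) F (b m) + ?S (Fs N) (b N) F (b m'))"
        unfolding K_def
        by (rule sup_pnorm_diff_quasi_triangle[OF assms(5,7,11,8) c \<kappa>])
      also have "\<dots> \<le> ennreal K * (ennreal \<delta> + ennreal \<delta>)"
        using that by (intro mult_left_mono add_mono less_imp_le[OF N]) auto
      also have "\<dots> = ennreal (\<epsilon> / 2)"
        using \<open>K > 0\<close> \<open>\<delta> > 0\<close> by (simp add: \<delta>_def flip: ennreal_plus ennreal_mult)
      also have "\<dots> < ennreal \<epsilon>"
        using \<open>\<epsilon> > 0\<close> by (simp add: ennreal_less_iff)
      finally show ?thesis .
    qed
    then show ?thesis
      by blast
  qed
  show "\<exists>r :: nat \<Rightarrow> nat. strict_mono r \<and> (\<forall>\<epsilon>>0. \<exists>m0. \<forall>m\<ge>m0. \<forall>m'\<ge>m0.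
      ?S F (b (r m)) F (b (r m')) < ennreal \<epsilon>)"
    using Cauchy by (intro exI[of _ id]) (simp add: strict_mono_def)
qed

end
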